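(* Let $(H,d)$ be a separable Hadamard space. Then any weakly sequentially compact set $K\subset H$ is weakly compact.
   Context: A Hadamard space is a complete $\mathrm{CAT}(0)$ space. For $x\in H$, $\Gamma_x(H)$ is the set of all constant speed geodesics $\gamma:[0,1]\to H$ (i.e. $d(\gamma(s),\gamma(t))=|s-t|\,d(\gamma(0),\gamma(1))$ for all $s,t\in[0,1]$) with $\gamma(0)=x$. For a geodesic $\gamma$, $P_\gamma$ denotes the metric projection onto (the image of) $\gamma$. Weak convergence: $x_n\overset{w}\to x$ means $P_\gamma x_n\to x$ in the metric $d$ for every $\gamma\in\Gamma_x(H)$ (no boundedness of $(x_n)$ is required). For $x\in H$, $\gamma_1,\dots,\gamma_n\in\Gamma_x(H)$, $\varepsilon>0$, let $U_x(\varepsilon;\gamma_1,\dots,\gamma_n):=\{y\in H: d(x,P_{\gamma_i}y)<\varepsilon,\ i=1,\dots,n\}$. Weak topology $\tau_w$: a set $U\subset H$ is weakly open if for every $x\in U$ there exist $\varepsilon>0$ and finitely many $\gamma_1,\dots,\gamma_n\in\Gamma_x(H)$ with $U_x(\varepsilon;\gamma_1,\dots,\gamma_n)\subseteq U$. The weakly open sets (together with $\emptyset$) form the topology $\tau_w$ on $H$. A set $K\subseteq H$ is weakly sequentially compact if every sequence in $K$ has a subsequence converging weakly to a point of $K$. $K$ is weakly compact if every cover of $K$ by sets from $\tau_w$ has a finite subcover. *)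

theory Defs
  imports "HOL-Analysis.Analysis"
begin

section \<open>Hadamard spaces\<close>

text \<open>Geodesics are total functions on \<^typ>\<open>real\<close>; only their values on \<open>[0,1]\<close> matter.\<close>

definition geodesic :: "(real \<Rightarrow> 'a::metric_space) \<Rightarrow> bool" where
  "geodesic \<gamma> \<longleftrightarrow>
     (\<forall>s\<in>{0..1}. \<forall>t\<in>{0..1}. dist (\<gamma> s) (\<gamma> t) = \<bar>s - t\<bar> * dist (\<gamma> 0) (\<gamma> 1))"

definition geodesics_from :: "'a::metric_space \<Rightarrow> (real \<Rightarrow> 'a) set" where
  "geodesics_from x = {\<gamma>. geodesic \<gamma> \<and> \<gamma> 0 = x}"

definition geodesic_between :: "(real \<Rightarrow> 'a::metric_space) \<Rightarrow> 'a \<Rightarrow> 'a \<Rightarrow> bool" where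
  "geodesic_between \<gamma> x y \<longleftrightarrow> geodesic \<gamma> \<and> \<gamma> 0 = x \<and> \<gamma> 1 = y"

type_synonym plane = "real^2"

text \<open>The points of the side \<open>\<gamma>\<close> of a geodesic triangle, each paired with its comparison point
  on the segment from \<open>P\<close> to \<open>Q\<close> in the Euclidean plane.\<close>

definition comparison_side ::
    "(real \<Rightarrow> 'a::metric_space) \<Rightarrow> plane \<Rightarrow> plane \<Rightarrow> ('a \<times> plane) set" where
  "comparison_side \<gamma> P Q = (\<lambda>t. (\<gamma> t, (1 - t) *\<^sub>R P + t *\<^sub>R Q)) ` {0..1}"

class cat0_space = metric_space +
  assumes geodesic_between_exists: "\<exists>\<gamma>. geodesic_between \<gamma> x y"
    and comparison_triangle:
      "\<lbrakk>geodesic_between \<alpha> p q; geodesic_between \<beta> q r; geodesic_between \<gamma> r p;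
        dist P Q = dist p q; dist Q R = dist q r; dist R P = dist r p;
        (x, X) \<in> comparison_side \<alpha> P Q \<union> comparison_side \<beta> Q R \<union> comparison_side \<gamma> R P;
        (y, Y) \<in> comparison_side \<alpha> P Q \<union> comparison_side \<beta> Q R \<union> comparison_side \<gamma> R P\<rbrakk>
       \<Longrightarrow> dist x y \<le> dist X Y"

class hadamard_space = cat0_space + complete_space

section \<open>Weak convergence and the weak topology\<close>

text \<open>In a Hadamard space the nearest point of a geodesic segment exists and is unique, so the
  choice made by \<^const>\<open>arg_min_on\<close> is the metric projection.\<close>

definition geodesic_proj :: "(real \<Rightarrow> 'a::metric_space) \<Rightarrow> 'a \<Rightarrow> 'a" where
  "geodesic_proj \<gamma> y = arg_min_on (\<lambda>z. dist y z) (\<gamma> ` {0..1})"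

definition weakly_converges :: "(nat \<Rightarrow> 'a::metric_space) \<Rightarrow> 'a \<Rightarrow> bool" where
  "weakly_converges X x \<longleftrightarrow>
     (\<forall>\<gamma>\<in>geodesics_from x. (\<lambda>n. geodesic_proj \<gamma> (X n)) \<longlonglongrightarrow> x)"

definition weak_nbhd :: "'a::metric_space \<Rightarrow> real \<Rightarrow> (real \<Rightarrow> 'a) set \<Rightarrow> 'a set" where
  "weak_nbhd x \<epsilon> G = {y. \<forall>\<gamma>\<in>G. dist x (geodesic_proj \<gamma> y) < \<epsilon>}"

definition weakly_open :: "'a::metric_space set \<Rightarrow> bool" where
  "weakly_open U \<longleftrightarrow>
     (\<forall>x\<in>U. \<exists>\<epsilon>>0. \<exists>G. finite G \<and> G \<noteq> {} \<and> G \<subseteq> geodesics_from x \<and> weak_nbhd x \<epsilon> G \<subseteq> U)"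

definition weak_topology :: "'a::metric_space topology" where
  "weak_topology = topology weakly_open"

lemma weakly_openI:
  assumes "\<And>x. x \<in> U \<Longrightarrow>
    \<exists>\<epsilon> G. \<epsilon> > 0 \<and> finite G \<and> G \<noteq> {} \<and> G \<subseteq> geodesics_from x \<and> weak_nbhd x \<epsilon> G \<subseteq> U"
  shows "weakly_open U"
  unfolding weakly_open_def using assms by simp

lemma weakly_openE:
  assumes "weakly_open U" "x \<in> U"
  obtains \<epsilon> G where "\<epsilon> > 0" "finite G" "G \<noteq> {}" "G \<subseteq> geodesics_from x" "weak_nbhd x \<epsilon> G \<subseteq> U"
  using bspec[OF assms(1)[unfolded weakly_open_def] assms(2)] by (elim exE conjE) (rule that)

lemma weak_nbhd_min_subset:
  "weak_nbhd x (min e1 e2) (G1 \<union> G2) \<subseteq> weak_nbhd x e1 G1 \<inter> weak_nbhd x e2 G2"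
proof (intro subsetI IntI)
  fix y assume y: "y \<in> weak_nbhd x (min e1 e2) (G1 \<union> G2)"
  have "dist x (geodesic_proj \<gamma> y) < min e1 e2" if "\<gamma> \<in> G1 \<union> G2" for \<gamma>
    using y that unfolding weak_nbhd_def by simp
  then show "y \<in> weak_nbhd x e1 G1" "y \<in> weak_nbhd x e2 G2"
    unfolding weak_nbhd_def by simp_all
qed

lemma istopology_weakly_open: "istopology weakly_open"
  unfolding istopology_def
proof (intro conjI allI impI)
  fix S T :: "'a set"
  assume S: "weakly_open S" and T: "weakly_open T"
  show "weakly_open (S \<inter> T)"
  proof (rule weakly_openI)
    fix x assume "x \<in> S \<inter> T"
    then have x: "x \<in> S" "x \<in> T" by simp_all
    obtain e1 G1 where 1: "e1 > 0" "finite G1" "G1 \<noteq> {}" "G1 \<subseteq> geodesics_from x"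
        "weak_nbhd x e1 G1 \<subseteq> S"
      by (rule weakly_openE[OF S x(1)])
    obtain e2 G2 where 2: "e2 > 0" "finite G2" "G2 \<noteq> {}" "G2 \<subseteq> geodesics_from x"
        "weak_nbhd x e2 G2 \<subseteq> T"
      by (rule weakly_openE[OF T x(2)])
    have "weak_nbhd x (min e1 e2) (G1 \<union> G2) \<subseteq> S \<inter> T"
      using weak_nbhd_min_subset[of x e1 e2 G1 G2] 1(5) 2(5) by blast
    moreover have "min e1 e2 > 0" "finite (G1 \<union> G2)" "G1 \<union> G2 \<noteq> {}"
        "G1 \<union> G2 \<subseteq> geodesics_from x"
      using 1 2 by simp_all
    ultimately show "\<exists>\<epsilon> G. \<epsilon> > 0 \<and> finite G \<and> G \<noteq> {} \<and> G \<subseteq> geodesics_from x \<and>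
        weak_nbhd x \<epsilon> G \<subseteq> S \<inter> T"
      by blast
  qed
next
  fix \<K> :: "'a set set"
  assume \<K>: "\<forall>K\<in>\<K>. weakly_open K"
  show "weakly_open (\<Union>\<K>)"
  proof (rule weakly_openI)
    fix x assume "x \<in> \<Union>\<K>"
    then obtain K where K: "x \<in> K" "K \<in> \<K>" by blast
    have "weakly_open K" using \<K> K(2) by blast
    then obtain e G where "e > 0" "finite G" "G \<noteq> {}" "G \<subseteq> geodesics_from x" "weak_nbhd x e G \<subseteq> K"
      using K(1) by (rule weakly_openE)
    moreover from this(5) have "weak_nbhd x e G \<subseteq> \<Union>\<K>" using K(2) by blast
    ultimately show "\<exists>\<epsilon> G. \<epsilon> > 0 \<and> finite G \<and> G \<noteq> {} \<and> G \<subseteq> geodesics_from x \<and>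
        weak_nbhd x \<epsilon> G \<subseteq> \<Union>\<K>"
      by blast
  qed
qed

lemma openin_weak_topology [simp]: "openin weak_topology U \<longleftrightarrow> weakly_open U"
  by (simp add: weak_topology_def topology_inverse' istopology_weakly_open)

lemma const_in_geodesics_from: "(\<lambda>_. x) \<in> geodesics_from x"
  by (simp add: geodesics_from_def geodesic_def)

lemma topspace_weak_topology [simp]: "topspace weak_topology = UNIV"
proof -
  have "weakly_open (UNIV :: 'a set)"
  proof (rule weakly_openI)
    fix x :: 'a
    show "\<exists>\<epsilon> G. \<epsilon> > 0 \<and> finite G \<and> G \<noteq> {} \<and> G \<subseteq> geodesics_from x \<and> weak_nbhd x \<epsilon> G \<subseteq> UNIV"
      using const_in_geodesics_from[of x]
      by (intro exI[of _ "1::real"] exI[of _ "{\<lambda>_. x}"]) simp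
  qed
  then show ?thesis
    using openin_subset[of weak_topology UNIV] by auto
qed

definition weakly_seq_compact :: "'a::metric_space set \<Rightarrow> bool" where
  "weakly_seq_compact K \<longleftrightarrow>
     (\<forall>X::nat \<Rightarrow> 'a. (\<forall>n. X n \<in> K) \<longrightarrow>
        (\<exists>x\<in>K. \<exists>r::nat \<Rightarrow> nat. strict_mono r \<and> weakly_converges (X \<circ> r) x))"

abbreviation weakly_compact :: "'a::metric_space set \<Rightarrow> bool" where
  "weakly_compact K \<equiv> compactin weak_topology K"

end

theory Submission
  imports Defs
begin

text \<open>
  Weakly open sets are open for the metric: by minimality, the projection of \<open>y\<close> to a geodesic
  issuing from \<open>x\<close> is no farther from \<open>y\<close> than \<open>x\<close> is, hence lies within \<open>2 d(x,y)\<close> of \<open>x\<close>, and so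
  every set \<open>U\<^sub>x(\<epsilon>; \<gamma>\<^sub>1, \<dots>, \<gamma>\<^sub>n)\<close> contains a metric ball around \<open>x\<close>
  (\<open>weakly_open_imp_open\<close>). A separable metric space is second countable, so each of its subsets
  is Lindelof for the metric topology, and therefore for the coarser weak topology as well: a weakly
  open cover of \<open>K\<close> has a countable subcover \<open>V\<^sub>0, V\<^sub>1, \<dots>\<close>
  (\<open>weakly_open_countable_subcover\<close>).

  If no finite part of it covered \<open>K\<close>, there would be points \<open>x\<^sub>n \<in> K\<close> outside
  \<open>V\<^sub>0 \<union> \<dots> \<union> V\<^sub>n\<close>. A subsequence converges weakly to some \<open>x \<in> K\<close>, which lies in some \<open>V\<^sub>m\<close>. Weak
  convergence puts the subsequence eventually into every \<open>U\<^sub>x(\<epsilon>; \<gamma>\<^sub>1, \<dots>, \<gamma>\<^sub>n)\<close>, in particular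
  into \<open>V\<^sub>m\<close>, contrary to the choice of the points \<open>x\<^sub>n\<close> with \<open>n \<ge> m\<close>
  (\<open>weakly_seq_compact_finite_subcover\<close>).
\<close>

text \<open>A geodesic is Lipschitz on \<open>[0,1]\<close>, so its image is compact and the distance to a given point
  is attained there.\<close>

lemma geodesic_proj_dist_le:
  fixes \<gamma> :: "real \<Rightarrow> 'a::metric_space"
  assumes "geodesic \<gamma>" and "z \<in> \<gamma> ` {0..1}"
  shows "dist y (geodesic_proj \<gamma> y) \<le> dist y z"
proof -
  have "(dist (\<gamma> 0) (\<gamma> 1))-lipschitz_on {0..1} \<gamma>"
  proof (rule lipschitz_onI)
    fix s t :: real assume "s \<in> {0..1}" "t \<in> {0..1}"
    then have "dist (\<gamma> s) (\<gamma> t) = dist s t * dist (\<gamma> 0) (\<gamma> 1)"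
      using assms(1) unfolding geodesic_def dist_real_def by blast
    then show "dist (\<gamma> s) (\<gamma> t) \<le> dist (\<gamma> 0) (\<gamma> 1) * dist s t"
      by (metis mult.commute order_refl)
  qed simp
  then have "compact (\<gamma> ` {0..1})"
    by (rule compact_continuous_image[OF lipschitz_on_continuous_on compact_Icc])
  moreover have "continuous_on (\<gamma> ` {0..1}) (dist y)"
    by (intro continuous_intros)
  ultimately obtain p where "p \<in> \<gamma> ` {0..1}" "\<forall>w\<in>\<gamma> ` {0..1}. dist y p \<le> dist y w"
    using continuous_attains_inf[of "\<gamma> ` {0..1}" "dist y"] assms(2) by blast
  then have "dist y (geodesic_proj \<gamma> y) = dist y p"
    unfolding geodesic_proj_def arg_min_on_def by (intro arg_min_equality) auto
  with \<open>\<forall>w\<in>\<gamma> ` {0..1}. dist y p \<le> dist y w\<close> assms(2) show ?thesis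
    by auto
qed

lemma dist_geodesic_proj_le:
  assumes "\<gamma> \<in> geodesics_from x"
  shows "dist x (geodesic_proj \<gamma> y) \<le> 2 * dist x y"
proof -
  have "x \<in> \<gamma> ` {0..1}"
    using assms by (auto simp: geodesics_from_def)
  then have "dist y (geodesic_proj \<gamma> y) \<le> dist y x"
    using assms by (intro geodesic_proj_dist_le) (auto simp: geodesics_from_def)
  then show ?thesis
    using dist_triangle[of x "geodesic_proj \<gamma> y" y] by (simp add: dist_commute)
qed

lemma ball_subset_weak_nbhd:
  assumes "G \<subseteq> geodesics_from x"
  shows "ball x (\<epsilon> / 2) \<subseteq> weak_nbhd x \<epsilon> G"
proof (clarsimp simp: weak_nbhd_def)
  fix y \<gamma> assume "dist x y * 2 < \<epsilon>" "\<gamma> \<in> G"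
  with dist_geodesic_proj_le[of \<gamma> x y] assms show "dist x (geodesic_proj \<gamma> y) < \<epsilon>"
    by auto
qed

lemma weakly_open_imp_open:
  assumes "weakly_open U"
  shows "open U"
  unfolding open_contains_ball
proof
  fix x assume "x \<in> U"
  with assms obtain \<epsilon> G where "\<epsilon> > 0" "G \<subseteq> geodesics_from x" "weak_nbhd x \<epsilon> G \<subseteq> U"
    by (rule weakly_openE)
  with ball_subset_weak_nbhd[of G x \<epsilon>] show "\<exists>e>0. ball x e \<subseteq> U"
    by (intro exI[of _ "\<epsilon> / 2"]) auto
qed

lemma separable_metric_imp_second_countable:
  assumes "separable_space (euclidean :: 'a::metric_space topology)"
  shows "second_countable (euclidean :: 'a topology)"
proof -
  obtain C :: "'a set" where C: "countable C" "closure C = UNIV"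
    using assms unfolding separable_space_def by auto
  let ?B = "(\<lambda>(c, n). ball c (1 / real (Suc n))) ` (C \<times> UNIV)"
  show ?thesis
    unfolding second_countable_def
  proof (intro exI[of _ ?B] conjI allI impI)
    show "countable ?B"
      using C(1) by (intro countable_image countable_SIGMA) auto
    show "\<forall>V\<in>?B. openin euclidean V"
      by auto
    fix U and x :: 'a assume "openin euclidean U \<and> x \<in> U"
    then obtain e where e: "e > 0" "ball x e \<subseteq> U"
      by (auto simp: open_contains_ball)
    \<comment> \<open>A centre within \<open>1/(n+1)\<close> of \<open>x\<close> gives a ball of that radius inside \<open>ball x (2/(n+1))\<close>.\<close>
    obtain n where n: "1 / real (Suc n) < e / 2"
      using nat_approx_posE[of "e / 2"] e(1) by auto
    have "x \<in> closure C"
      using C(2) by simp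
    moreover have "1 / real (Suc n) > 0"
      by simp
    ultimately obtain c where c: "c \<in> C" "dist c x < 1 / real (Suc n)"
      unfolding closure_approachable by blast
    have "ball c (1 / real (Suc n)) \<subseteq> ball x e"
    proof
      fix y assume "y \<in> ball c (1 / real (Suc n))"
      then show "y \<in> ball x e"
        using c(2) n dist_triangle[of x y c] unfolding mem_ball dist_commute[of x c] by linarith
    qed
    with e(2) c show "\<exists>V\<in>?B. x \<in> V \<and> V \<subseteq> U"
      by (intro bexI[of _ "ball c (1 / real (Suc n))"]) auto
  qed
qed

lemma weakly_open_countable_subcover:
  fixes K :: "'a::metric_space set"
  assumes "separable_space (euclidean :: 'a topology)"
    and "\<And>U. U \<in> \<U> \<Longrightarrow> weakly_open U" and "K \<subseteq> \<Union>\<U>"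
  obtains \<V> where "countable \<V>" "\<V> \<subseteq> \<U>" "K \<subseteq> \<Union>\<V>"
proof -
  have "Lindelof_space (subtopology euclidean K)"
    using assms(1)
    by (intro second_countable_imp_Lindelof_space second_countable_subtopology
        separable_metric_imp_second_countable)
  moreover have "\<forall>U\<in>\<U>. openin euclidean U"
    using assms(2) weakly_open_imp_open by auto
  ultimately show ?thesis
    using assms(3) that by (auto simp: Lindelof_space_subtopology_subset)
qed

text \<open>Although weak convergence is defined through projections, it implies convergence in the weak
  topology: membership in the neighbourhoods that define weakly open sets involves only finitely
  many geodesics.\<close>

lemma weakly_converges_eventually_in:
  assumes "weakly_converges X x" and "weakly_open U" and "x \<in> U"
  shows "eventually (\<lambda>n. X n \<in> U) sequentially"
proof -
  obtain \<epsilon> G where G: "\<epsilon> > 0" "finite G" "G \<subseteq> geodesics_from x" "weak_nbhd x \<epsilon> G \<subseteq> U"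
    by (rule weakly_openE[OF assms(2,3)])
  have "\<forall>\<gamma>\<in>G. eventually (\<lambda>n. dist x (geodesic_proj \<gamma> (X n)) < \<epsilon>) sequentially"
    using assms(1) G(1,3) unfolding weakly_converges_def by (auto simp: tendsto_iff dist_commute)
  then have "eventually (\<lambda>n. \<forall>\<gamma>\<in>G. dist x (geodesic_proj \<gamma> (X n)) < \<epsilon>) sequentially"
    using G(2) by (simp add: eventually_ball_finite_distrib)
  then show ?thesis
    by (rule eventually_mono) (use G(4) in \<open>auto simp: weak_nbhd_def\<close>)
qed

lemma weakly_seq_compact_finite_subcover:
  fixes V :: "nat \<Rightarrow> 'a::metric_space set"
  assumes "weakly_seq_compact K" and "\<And>i. weakly_open (V i)" and "K \<subseteq> (\<Union>i. V i)"
  obtains n where "K \<subseteq> (\<Union>i\<le>n. V i)"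
proof (rule ccontr)
  assume "\<not> thesis"
  then have "\<forall>n. \<exists>y. y \<in> K \<and> y \<notin> (\<Union>i\<le>n. V i)"
    using that by blast
  then obtain X where X: "\<And>n. X n \<in> K" "\<And>n. X n \<notin> (\<Union>i\<le>n. V i)"
    by metis
  then obtain x r where r: "x \<in> K" "strict_mono r" "weakly_converges (X \<circ> r) x"
    using assms(1) unfolding weakly_seq_compact_def by blast
  obtain m where "x \<in> V m"
    using r(1) assms(3) by blast
  then have "eventually (\<lambda>k. (X \<circ> r) k \<in> V m) sequentially"
    by (rule weakly_converges_eventually_in[OF r(3) assms(2)])
  then obtain k where "k \<ge> m" "X (r k) \<in> V m"
    unfolding eventually_sequentially comp_def by (meson nat_le_linear)
  moreover have "r k \<ge> k"
    using r(2) by (rule seq_suble)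
  ultimately show False
    using X(2)[of "r k"] by auto
qed

theorem theorem5:
  fixes K :: "'a::hadamard_space set"
  assumes "separable_space (euclidean :: 'a topology)"
    and "weakly_seq_compact K"
  shows "weakly_compact K"
  unfolding compactin_def
proof (intro conjI allI impI)
  show "K \<subseteq> topspace weak_topology"
    by simp
  fix \<U> :: "'a set set"
  assume "(\<forall>U\<in>\<U>. openin weak_topology U) \<and> K \<subseteq> \<Union>\<U>"
  then have \<U>: "\<And>U. U \<in> \<U> \<Longrightarrow> weakly_open U" "K \<subseteq> \<Union>\<U>"
    by auto
  obtain \<V> where \<V>: "countable \<V>" "\<V> \<subseteq> \<U>" "K \<subseteq> \<Union>\<V>"
    using weakly_open_countable_subcover[OF assms(1) \<U>] by blast
  show "\<exists>\<F>. finite \<F> \<and> \<F> \<subseteq> \<U> \<and> K \<subseteq> \<Union>\<F>"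
  proof (cases "\<V> = {}")
    case True
    with \<V>(3) show ?thesis
      by (intro exI[of _ "{}"]) auto
  next
    case False
    define V where "V = from_nat_into \<V>"
    have range: "range V = \<V>"
      unfolding V_def using False \<V>(1) by (rule range_from_nat_into)
    have "\<And>i. weakly_open (V i)"
      using range \<V>(2) \<U>(1) by blast
    moreover have "K \<subseteq> (\<Union>i. V i)"
      using range \<V>(3) by simp
    ultimately obtain n where "K \<subseteq> (\<Union>i\<le>n. V i)"
      using weakly_seq_compact_finite_subcover[OF assms(2)] by blast
    then show ?thesis
      using range \<V>(2) by (intro exI[of _ "V ` {..n}"]) auto
  qed
qed

end
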